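(* Let $k>0$, $\mathcal{D}_1=\{w\in\mathbb{C}:|w|<1\}$, and for $x=(z,w)$, $x'=(z',w')$ in $\mathbb{C}\times\mathcal{D}_1$ let $$K(x,x')=(1-\bar w w')^{-2k}\exp\frac{2\bar z z'+z'^2\bar w+\bar z^2w'}{2(1-\bar w w')} .$$ Let $h=(g,\alpha)$ with $\alpha\in\mathbb{C}$ and $g=\begin{pmatrix}a&b\\ \bar b&\bar a\end{pmatrix}\in \mathrm{SU}(1,1)$, $|a|^2-|b|^2=1$, act on $\mathbb{C}\times\mathcal{D}_1$ by $$h\cdot(z,w)=\Big(\frac{\gamma}{\kappa},\frac{aw+b}{\kappa}\Big),\qquad \kappa=\bar a+\bar b w,\qquad \gamma=z+\alpha-\bar\alpha w .$$ Then the multiplier of the corresponding holomorphic representation of the Jacobi group is given by $$J(h,x)=(\bar a+\bar b w)^{2k}\exp\frac12\Big[\frac{\bar b}{\kappa}\gamma^2+\bar\alpha(z+\gamma)\Big],$$ that is, $$K(h\cdot x,h\cdot x')=\overline{J(h,x)}\;K(x,x')\;J(h,x')\qquad\text{for all }x,x'\in\mathbb{C}\times\mathcal{D}_1 .$$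
   Context: The Jacobi group is $G^J_1=H_1\rtimes \mathrm{SU}(1,1)$, the semidirect product of the 3-dimensional real Heisenberg-Weyl group and $\mathrm{SU}(1,1)$; elements (modulo the center of $H_1$) are written $h=(g,\alpha)$, $g\in\mathrm{SU}(1,1)$, $\alpha\in\mathbb{C}$. A multiplier for a kernel $K$ is a function $J(h,x)$ satisfying $K(h\cdot x,h\cdot x')=\overline{J(h,x)}K(x,x')J(h,x')$; in terms of coherent state vectors $e_x$ with $(e_x,e_{x'})=K(x,x')$ (scalar product antilinear in the first argument) it corresponds to $\pi(h)_k e_x=J(h,x)^{-1}e_{h\cdot x}$. The power $(1-\bar w w')^{-2k}$ is the principal branch. For each fixed $g$, the function $w\mapsto\bar a+\bar b w$ is nowhere zero on $\mathcal{D}_1$, and $(\bar a+\bar b w)^{2k}$ denotes $\exp(2kL(w))$ for any fixed holomorphic branch $L$ of its logarithm on $\mathcal{D}_1$; the product $\overline{J(h,x)}J(h,x')$ does not depend on this choice. *)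

theory Defs
  imports "HOL-Analysis.Analysis"
begin

definition unit_disc :: "complex set" where
  "unit_disc = {w. cmod w < 1}"

definition phase_space :: "(complex \<times> complex) set" where
  "phase_space = UNIV \<times> unit_disc"

definition SU11 :: "(complex^2^2) set" where
  "SU11 = {g. \<exists>a b. g = vector [vector [a, b], vector [cnj b, cnj a]]
                 \<and> (cmod a)\<^sup>2 - (cmod b)\<^sup>2 = 1}"

text \<open>The Jacobi group is represented modulo the centre of the Heisenberg group, by the
  pairs \<open>(g, \<alpha>)\<close>. The entries \<open>a\<close> and \<open>b\<close> of \<open>g\<close> are \<open>g $ 1 $ 1\<close> and \<open>g $ 1 $ 2\<close>.\<close>

type_synonym jacobi = "(complex^2^2) \<times> complex"

definition jacobi_group :: "jacobi set" where
  "jacobi_group = SU11 \<times> UNIV"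

definition kappa :: "complex^2^2 \<Rightarrow> complex \<Rightarrow> complex" where
  "kappa g w = cnj (g $ 1 $ 1) + cnj (g $ 1 $ 2) * w"

definition gam :: "complex \<Rightarrow> complex \<times> complex \<Rightarrow> complex" where
  "gam \<alpha> = (\<lambda>(z, w). z + \<alpha> - cnj \<alpha> * w)"

definition jacobi_act :: "jacobi \<Rightarrow> complex \<times> complex \<Rightarrow> complex \<times> complex" where
  "jacobi_act = (\<lambda>(g, \<alpha>) (z, w).
     (gam \<alpha> (z, w) / kappa g w, (g $ 1 $ 1 * w + g $ 1 $ 2) / kappa g w))"

definition jacobi_kernel :: "real \<Rightarrow> complex \<times> complex \<Rightarrow> complex \<times> complex \<Rightarrow> complex" where
  "jacobi_kernel k = (\<lambda>(z, w) (z', w').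
     (1 - cnj w * w') powr (complex_of_real (- 2 * k)) *
     exp ((2 * cnj z * z' + z'\<^sup>2 * cnj w + (cnj z)\<^sup>2 * w') / (2 * (1 - cnj w * w'))))"

text \<open>The power \<open>\<kappa>\<^sup>2\<^sup>k\<close> in the multiplier is not in general the principal branch: \<open>L g\<close> is
  any holomorphic branch of \<open>log \<kappa>\<close> on the disc.\<close>

definition kappa_log_branch :: "complex^2^2 \<Rightarrow> (complex \<Rightarrow> complex) \<Rightarrow> bool" where
  "kappa_log_branch g l \<longleftrightarrow>
     l holomorphic_on unit_disc \<and> (\<forall>w\<in>unit_disc. exp (l w) = kappa g w)"

definition jacobi_J ::
  "real \<Rightarrow> (complex^2^2 \<Rightarrow> complex \<Rightarrow> complex) \<Rightarrow> jacobi \<Rightarrow> complex \<times> complex \<Rightarrow> complex" where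
  "jacobi_J k L = (\<lambda>(g, \<alpha>) (z, w).
     exp (complex_of_real (2 * k) * L g w) *
     exp (1 / 2 * (cnj (g $ 1 $ 2) / kappa g w * (gam \<alpha> (z, w))\<^sup>2
                   + cnj \<alpha> * (z + gam \<alpha> (z, w)))))"

definition is_multiplier ::
  "'h set \<Rightarrow> 'x set \<Rightarrow> ('h \<Rightarrow> 'x \<Rightarrow> 'x) \<Rightarrow> ('x \<Rightarrow> 'x \<Rightarrow> complex) \<Rightarrow> ('h \<Rightarrow> 'x \<Rightarrow> complex) \<Rightarrow> bool" where
  "is_multiplier G X act K J \<longleftrightarrow>
     (\<forall>h\<in>G. \<forall>x\<in>X. \<forall>x'\<in>X. K (act h x) (act h x') = cnj (J h x) * K x x' * J h x')"

lemma SU11_iff: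
  "g \<in> SU11 \<longleftrightarrow> g $ 2 $ 1 = cnj (g $ 1 $ 2) \<and> g $ 2 $ 2 = cnj (g $ 1 $ 1)
     \<and> (cmod (g $ 1 $ 1))\<^sup>2 - (cmod (g $ 1 $ 2))\<^sup>2 = 1"
  by (auto simp: SU11_def vec_eq_iff forall_2)

lemma SU11_norm_less:
  assumes "g \<in> SU11"
  shows "cmod (g $ 1 $ 2) < cmod (g $ 1 $ 1)"
proof -
  have "(cmod (g $ 1 $ 2))\<^sup>2 < (cmod (g $ 1 $ 1))\<^sup>2"
    using assms by (simp add: SU11_iff)
  then show ?thesis
    by (rule power_less_imp_less_base) simp
qed

lemma kappa_quotient_bound:
  assumes "g \<in> SU11" "w \<in> unit_disc"
  shows "cmod (cnj (g $ 1 $ 2) / cnj (g $ 1 $ 1) * w) < 1"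
proof -
  have "cmod (g $ 1 $ 2) * cmod w \<le> cmod (g $ 1 $ 2) * 1"
    using assms(2) by (intro mult_left_mono) (auto simp: unit_disc_def)
  also have "\<dots> < cmod (g $ 1 $ 1)"
    using SU11_norm_less[OF assms(1)] by simp
  finally have "cmod (g $ 1 $ 2) * cmod w < cmod (g $ 1 $ 1)" .
  moreover have "0 < cmod (g $ 1 $ 1)"
    using SU11_norm_less[OF assms(1)] norm_ge_zero[of "g $ 1 $ 2"] by linarith
  ultimately show ?thesis
    by (simp add: norm_mult norm_divide divide_simps)
qed

lemma SU11_entry_nz:
  assumes "g \<in> SU11"
  shows "g $ 1 $ 1 \<noteq> 0"
  using SU11_norm_less[OF assms] by auto

lemma kappa_factor:
  assumes "g \<in> SU11"
  shows "kappa g w = cnj (g $ 1 $ 1) * (1 + cnj (g $ 1 $ 2) / cnj (g $ 1 $ 1) * w)"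
  using SU11_entry_nz[OF assms] by (simp add: kappa_def field_simps)

lemma Re_one_plus_pos:
  assumes "cmod u < 1"
  shows "0 < Re (1 + u)"
  using assms abs_Re_le_cmod[of u] by simp

lemma kappa_nz:
  assumes "g \<in> SU11" "w \<in> unit_disc"
  shows "kappa g w \<noteq> 0"
proof -
  have "0 < Re (1 + cnj (g $ 1 $ 2) / cnj (g $ 1 $ 1) * w)"
    by (rule Re_one_plus_pos) (rule kappa_quotient_bound[OF assms])
  then have "1 + cnj (g $ 1 $ 2) / cnj (g $ 1 $ 1) * w \<noteq> 0"
    by (metis less_irrefl zero_complex.sel(1))
  then show ?thesis
    using SU11_entry_nz[OF assms(1)] by (simp add: kappa_factor[OF assms(1)])
qed

lemma kappa_log_branch_exists:
  assumes g: "g \<in> SU11"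
  shows "\<exists>l. kappa_log_branch g l"
proof -
  let ?q = "cnj (g $ 1 $ 2) / cnj (g $ 1 $ 1)"
  let ?l = "\<lambda>w. Ln (cnj (g $ 1 $ 1)) + Ln (1 + ?q * w)"
  have pos: "0 < Re (1 + ?q * w)" if "w \<in> unit_disc" for w
    by (rule Re_one_plus_pos) (rule kappa_quotient_bound[OF g that])
  have "?l holomorphic_on unit_disc"
    by (intro holomorphic_intros) (use pos in \<open>force simp: complex_nonpos_Reals_iff\<close>)
  moreover have "exp (?l w) = kappa g w" if "w \<in> unit_disc" for w
  proof -
    have "1 + ?q * w \<noteq> 0"
      using pos[OF that] by (metis less_irrefl zero_complex.sel(1))
    then show ?thesis
      using SU11_entry_nz[OF g] by (simp add: exp_add kappa_factor[OF g])
  qed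
  ultimately show ?thesis
    unfolding kappa_log_branch_def by blast
qed

lemma jacobi_act_in_phase_space:
  assumes h: "h \<in> jacobi_group" and x: "x \<in> phase_space"
  shows "jacobi_act h x \<in> phase_space"
proof -
  obtain g \<alpha> z w where hx: "h = (g, \<alpha>)" "x = (z, w)"
    by (cases h, cases x) auto
  have g: "g \<in> SU11" and w: "w \<in> unit_disc"
    using h x by (auto simp: hx jacobi_group_def phase_space_def)
  define a b where ab: "a = g $ 1 $ 1" "b = g $ 1 $ 2"
  have n: "(cmod a)\<^sup>2 - (cmod b)\<^sup>2 = 1"
    using g by (simp add: SU11_iff ab)
  have "(cmod (kappa g w))\<^sup>2 - (cmod (a * w + b))\<^sup>2
      = ((cmod a)\<^sup>2 - (cmod b)\<^sup>2) * (1 - (cmod w)\<^sup>2)"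
    unfolding kappa_def ab[symmetric] cmod_power2 by (simp add: algebra_simps power2_eq_square)
  also have "\<dots> > 0"
    using w by (simp add: n unit_disc_def abs_square_less_1)
  finally have "(cmod (a * w + b))\<^sup>2 < (cmod (kappa g w))\<^sup>2"
    by simp
  then have "cmod (a * w + b) < cmod (kappa g w)"
    by (rule power_less_imp_less_base) simp
  then have "cmod ((a * w + b) / kappa g w) < 1"
    using kappa_nz[OF g w] by (simp add: norm_divide)
  then show ?thesis
    by (simp add: hx jacobi_act_def phase_space_def unit_disc_def ab)
qed

end

theory Submission imports Defs begin

text \<open>The exponent of the kernel is rational in \<open>z'\<close>, \<open>w'\<close> and the conjugates of \<open>z\<close>, \<open>w\<close>;
  treating these four as independent variables, its transformation law splits into the
  translation by \<open>\<alpha>\<close> followed by the Moebius action of \<open>g\<close>. The powers match up to a factor whose logarithm is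
  continuous on the disc, takes values in \<open>2 \<pi> \<i> \<int>\<close>, and vanishes on the diagonal \<open>w = w'\<close>.\<close>

text \<open>\<open>(y, u)\<close> takes the place of the conjugated first point and
  \<open>(z, w)\<close> is the second point; without conjugation every identity below is one of
  rational functions.\<close>

definition kernel_exponent :: "complex \<Rightarrow> complex \<Rightarrow> complex \<Rightarrow> complex \<Rightarrow> complex" where
  "kernel_exponent y u z w = (2 * y * z + z\<^sup>2 * u + y\<^sup>2 * w) / (2 * (1 - u * w))"

text \<open>Here \<open>\<beta>\<close> stands for \<open>cnj \<alpha>\<close>. The translation
  keeps \<open>u\<close>, \<open>w\<close> and hence the denominator, and the increment of the
  numerator is divisible by \<open>1 - u * w\<close>, so only a polynomial is added.\<close>

lemma kernel_exponent_translate: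
  assumes "1 - u * w \<noteq> 0"
  shows "kernel_exponent (y + \<beta> - \<alpha> * u) u (z + \<alpha> - \<beta> * w) w
    = kernel_exponent y u z w + \<alpha> * (y + (y + \<beta> - \<alpha> * u)) / 2 + \<beta> * (z + (z + \<alpha> - \<beta> * w)) / 2"
  using assms unfolding kernel_exponent_def
  by (simp add: divide_simps) algebra

text \<open>Over the common denominator the mixed terms cancel and the numerator becomes
  \<open>(a * c - b * d) * (1 - u * w)\<close>. In use, \<open>c\<close> and \<open>d\<close> are
  the conjugates of \<open>a\<close> and \<open>b\<close>.\<close>

lemma one_minus_moebius:
  fixes a b c d u w :: complex
  assumes "a * c - b * d = 1" and "c + d * w \<noteq> 0" and "a + b * u \<noteq> 0"
  shows "1 - (c * u + d) / (a + b * u) * ((a * w + b) / (c + d * w))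
    = (1 - u * w) / ((a + b * u) * (c + d * w))"
  using assms by (simp add: divide_simps) algebra

lemma kernel_exponent_moebius:
  fixes a b c d u w y z :: complex
  assumes det: "a * c - b * d = 1" and nz: "1 - u * w \<noteq> 0" "c + d * w \<noteq> 0" "a + b * u \<noteq> 0"
  shows "kernel_exponent (y / (a + b * u)) ((c * u + d) / (a + b * u))
      (z / (c + d * w)) ((a * w + b) / (c + d * w))
    = kernel_exponent y u z w + b / (a + b * u) * y\<^sup>2 / 2 + d / (c + d * w) * z\<^sup>2 / 2"
proof -
  define p q where pq: "p = a + b * u" "q = c + d * w"
  have nz': "p \<noteq> 0" "q \<noteq> 0" using nz by (auto simp: pq)
  have "kernel_exponent (y / p) ((c * u + d) / p) (z / q) ((a * w + b) / q)
      = (2 * y * z + z\<^sup>2 * ((c * u + d) / q) + y\<^sup>2 * ((a * w + b) / p)) / (2 * (1 - u * w))"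
    unfolding kernel_exponent_def pq one_minus_moebius[OF det nz(2,3)]
    unfolding pq[symmetric] using nz(1) nz'
    by (simp add: divide_simps power2_eq_square)
  \<comment> \<open>This is \<open>c * u + d = u * q + d * (1 - u * w)\<close>: the excess over
    \<open>u\<close> carries the factor that cancels the denominator of the exponent, which leaves
    the quadratic term in \<open>z\<close>. The next identity does the same for
    \<open>y\<close>.\<close>
  moreover have "(c * u + d) / q = u + d * (1 - u * w) / q"
    using nz' by (simp add: divide_simps) (simp add: pq algebra_simps)
  moreover have "(a * w + b) / p = w + b * (1 - u * w) / p"
    using nz' by (simp add: divide_simps) (simp add: pq algebra_simps)
  \<comment> \<open>\<open>D\<close> is \<open>1 - u * w\<close>, kept opaque so that it cancels as
    one factor.\<close>
  moreover have "(2 * y * z + z\<^sup>2 * (u + d * D / q) + y\<^sup>2 * (w + b * D / p)) / (2 * D)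
      = (2 * y * z + z\<^sup>2 * u + y\<^sup>2 * w) / (2 * D) + b / p * y\<^sup>2 / 2 + d / q * z\<^sup>2 / 2"
    if "D \<noteq> 0" for D
    using that by (simp add: add_divide_distrib distrib_left mult.commute)
  ultimately show ?thesis
    using nz(1) by (simp only: pq kernel_exponent_def not_False_eq_True)
qed

text \<open>The values of \<open>F\<close> are integer multiples of \<open>2 * pi * \<i>\<close>, a
  discrete set, and a continuous map from a connected set into a discrete one is constant.\<close>

lemma continuous_exp_eq_1_constant:
  fixes F :: "'a::topological_space \<Rightarrow> complex"
  assumes "connected S" and "continuous_on S F" and F1: "\<And>x. x \<in> S \<Longrightarrow> exp (F x) = 1"
  shows "F constant_on S"
proof (rule continuous_discrete_range_constant[OF assms(1,2)])
  fix x assume x: "x \<in> S"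
  \<comment> \<open>Distinct values are at least \<open>2 * pi\<close> apart; 1 is a convenient
    smaller gap.\<close>
  have "1 \<le> norm (F y - F x)" if "y \<in> S" "F y \<noteq> F x" for y
  proof (rule ccontr)
    assume "\<not> 1 \<le> norm (F y - F x)"
    then have "norm (F y - F x) < 2 * pi" using pi_gt3 by linarith
    moreover have "exp (F y) = exp (F x)" using F1 x that(1) by simp
    moreover have "\<bar>Im (F y) - Im (F x)\<bar> \<le> norm (F y - F x)"
      using abs_Im_le_cmod[of "F y - F x"] by simp
    ultimately show False
      using that(2) exp_complex_eqI[of "F y" "F x"] by simp
  qed
  then show "\<exists>e>0. \<forall>y. y \<in> S \<and> F y \<noteq> F x \<longrightarrow> e \<le> norm (F y - F x)"
    by (intro exI[of _ 1]) auto
qed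

text \<open>Keeps the base of the kernel's power in the right half-plane, away from zero and from
  the cut of \<open>Ln\<close>.\<close>

lemma Re_one_minus_cnj_mult_pos:
  assumes "w \<in> unit_disc" "v \<in> unit_disc"
  shows "0 < Re (1 - cnj w * v)"
proof -
  have "cmod (- (cnj w * v)) < 1"
    using assms mult_strict_mono'[of "cmod w" 1 "cmod v" 1]
    by (simp add: unit_disc_def norm_mult)
  from Re_one_plus_pos[OF this] show ?thesis by simp
qed

lemma moebius_in_unit_disc:
  assumes "g \<in> SU11" "w \<in> unit_disc"
  shows "(g $ 1 $ 1 * w + g $ 1 $ 2) / kappa g w \<in> unit_disc"
  using jacobi_act_in_phase_space[of "(g, 0)" "(0, w)"] assms
  by (simp add: jacobi_group_def phase_space_def jacobi_act_def)

lemma one_minus_cnj_mult_moebius: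
  assumes g: "g \<in> SU11" and w: "w \<in> unit_disc" and v: "v \<in> unit_disc"
  shows "1 - cnj ((g $ 1 $ 1 * w + g $ 1 $ 2) / kappa g w)
        * ((g $ 1 $ 1 * v + g $ 1 $ 2) / kappa g v)
    = (1 - cnj w * v) / (cnj (kappa g w) * kappa g v)"
proof -
  have det: "g $ 1 $ 1 * cnj (g $ 1 $ 1) - g $ 1 $ 2 * cnj (g $ 1 $ 2) = 1"
    using g by (simp add: SU11_iff flip: complex_norm_square of_real_power of_real_diff)
  have "cnj (kappa g w) \<noteq> 0" "kappa g v \<noteq> 0"
    using kappa_nz g w v by auto
  then show ?thesis
    using one_minus_moebius[OF det, of v "cnj w"] by (simp add: kappa_def)
qed

text \<open>Reconciles the principal branch in the kernel with the arbitrary branch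
  \<open>l\<close>. Adding a multiple of \<open>2 * pi * \<i>\<close> to \<open>l\<close> changes
  nothing, since it cancels in \<open>cnj (l w) + l v\<close>.\<close>

lemma Ln_one_minus_moebius:
  assumes g: "g \<in> SU11" and l: "kappa_log_branch g l"
    and w: "w \<in> unit_disc" and v: "v \<in> unit_disc"
  shows "Ln (1 - cnj ((g $ 1 $ 1 * w + g $ 1 $ 2) / kappa g w)
        * ((g $ 1 $ 1 * v + g $ 1 $ 2) / kappa g v))
    = Ln (1 - cnj w * v) - cnj (l w) - l v"
proof -
  define m where "m = (\<lambda>v. (g $ 1 $ 1 * v + g $ 1 $ 2) / kappa g v)"
  \<comment> \<open>The defect of the claim as a function of the second point, with \<open>w\<close>
    fixed.\<close>
  define F where "F = (\<lambda>v. Ln (1 - cnj (m w) * m v) - (Ln (1 - cnj w * v) - cnj (l w) - l v))"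
  have m: "m x \<in> unit_disc" if "x \<in> unit_disc" for x
    unfolding m_def by (rule moebius_in_unit_disc[OF g that])
  have el: "exp (l x) = kappa g x" if "x \<in> unit_disc" for x
    using l that by (simp add: kappa_log_branch_def)
  have pos: "0 < Re (1 - cnj w * x)" "0 < Re (1 - cnj (m w) * m x)" if "x \<in> unit_disc" for x
    using Re_one_minus_cnj_mult_pos m w that by blast+
  have nz: "1 - cnj w * x \<noteq> 0" "1 - cnj (m w) * m x \<noteq> 0" if "x \<in> unit_disc" for x
    using pos[OF that] by (metis less_irrefl zero_complex.sel(1))+
  have "continuous_on unit_disc l"
    using l holomorphic_on_imp_continuous_on kappa_log_branch_def by blast
  moreover have "continuous_on unit_disc m"
    unfolding m_def kappa_def
    by (intro continuous_intros) (use kappa_nz[OF g] in \<open>auto simp: kappa_def\<close>)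
  ultimately have "continuous_on unit_disc F"
    unfolding F_def
    by (intro continuous_intros) (use pos in \<open>force simp: complex_nonpos_Reals_iff\<close>)+
  moreover have "exp (F x) = 1" if x: "x \<in> unit_disc" for x
  proof -
    have "exp (F x) = (1 - cnj (m w) * m x)
        / ((1 - cnj w * x) / (cnj (kappa g w) * kappa g x))"
      using nz[OF x] el[OF x] el[OF w] by (simp add: F_def exp_diff flip: exp_cnj)
    also have "\<dots> = 1"
      using one_minus_cnj_mult_moebius[OF g w x] nz[OF x] by (simp add: m_def)
    finally show ?thesis .
  qed
  moreover have "connected unit_disc"
  proof -
    have "unit_disc = ball 0 1" by (auto simp: unit_disc_def)
    then show ?thesis by (metis convex_ball convex_connected)
  qed
  ultimately have "F constant_on unit_disc"
    by (intro continuous_exp_eq_1_constant)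
  \<comment> \<open>At the diagonal both arguments of \<open>Ln\<close> are positive reals and
    \<open>cnj (l w) + l w\<close> is real, so \<open>F w\<close> is real; the only real number with
    exponential 1 is 0.\<close>
  moreover have "F w = 0"
  proof -
    have real_Ln: "Im (Ln (1 - cnj x * x)) = 0" if "x \<in> unit_disc" for x
    proof -
      have "1 - cnj x * x = of_real (1 - (cmod x)\<^sup>2)"
        using complex_norm_square[of x] by (simp add: mult.commute)
      moreover have "0 < 1 - (cmod x)\<^sup>2"
        using that by (simp add: unit_disc_def abs_square_less_1)
      ultimately show ?thesis by (metis Im_Ln_of_real)
    qed
    have "Im (F w) = 0"
      using real_Ln[OF w] real_Ln[OF m[OF w]] by (simp add: F_def)
    moreover have "exp (F w) = exp 0"
      using \<open>\<And>x. x \<in> unit_disc \<Longrightarrow> exp (F x) = 1\<close>[OF w] by simp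
    ultimately show ?thesis
      using exp_complex_eqI[of "F w" 0] pi_gt_zero by simp
  qed
  ultimately have "F v = 0"
    using v w by (metis constant_on_def)
  then show ?thesis by (simp add: F_def m_def)
qed

theorem mainTheorem3:
  fixes k :: real and L :: "complex^2^2 \<Rightarrow> complex \<Rightarrow> complex"
  assumes "k > 0"
    and "\<And>g. g \<in> SU11 \<Longrightarrow> kappa_log_branch g (L g)"
  shows "is_multiplier jacobi_group phase_space jacobi_act (jacobi_kernel k) (jacobi_J k L)"
  unfolding is_multiplier_def
proof (intro ballI)
  fix h x x' assume "h \<in> jacobi_group" "x \<in> phase_space" "x' \<in> phase_space"
  then obtain g \<alpha> z w z' w' where eqs: "h = (g, \<alpha>)" "x = (z, w)" "x' = (z', w')"
    and g: "g \<in> SU11" and w: "w \<in> unit_disc" and w': "w' \<in> unit_disc"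
    by (auto simp: jacobi_group_def phase_space_def)
  define a b where ab: "a = g $ 1 $ 1" "b = g $ 1 $ 2"
  define m where "m = (\<lambda>v. (a * v + b) / kappa g v)"
  define y y' where yy: "y = gam \<alpha> (z, w)" "y' = gam \<alpha> (z', w')"
  \<comment> \<open>Written as a single exponential, the kernel turns the multiplicative law into an
    additive one for exponents.\<close>
  have kernel: "jacobi_kernel k (s, u) (t, v)
      = exp (- 2 * k * Ln (1 - cnj u * v) + kernel_exponent (cnj s) (cnj u) t v)"
    if "u \<in> unit_disc" "v \<in> unit_disc" for s u t v
  proof -
    \<comment> \<open>\<open>powr\<close> takes the default value 0 at base 0, so its exponential
      form requires a nonzero base.\<close>
    have "1 - cnj u * v \<noteq> 0"
      using Re_one_minus_cnj_mult_pos[OF that] by (metis less_irrefl zero_complex.sel(1))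
    then show ?thesis
      by (simp add: jacobi_kernel_def kernel_exponent_def powr_def exp_add exp_diff exp_minus divide_inverse)
  qed
  have nz: "1 - cnj w * w' \<noteq> 0"
    using Re_one_minus_cnj_mult_pos[OF w w'] by (metis less_irrefl zero_complex.sel(1))
  have det: "a * cnj a - b * cnj b = 1"
    using g by (simp add: SU11_iff ab flip: complex_norm_square of_real_power of_real_diff)
  have kap: "kappa g w' = cnj a + cnj b * w'" "cnj (kappa g w) = a + b * cnj w"
    by (simp_all add: kappa_def ab)
  have knz: "kappa g w' \<noteq> 0" "cnj (kappa g w) \<noteq> 0"
    using kappa_nz g w w' by auto
  \<comment> \<open>The Moebius law is applied to the translated coordinates \<open>y\<close>,
    \<open>y'\<close>; \<open>tra\<close> then returns from these to \<open>z\<close>,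
    \<open>z'\<close>.\<close>
  have mob: "kernel_exponent (cnj (y / kappa g w)) (cnj (m w)) (y' / kappa g w') (m w')
      = kernel_exponent (cnj y) (cnj w) y' w'
        + b / cnj (kappa g w) * (cnj y)\<^sup>2 / 2 + cnj b / kappa g w' * y'\<^sup>2 / 2"
    using kernel_exponent_moebius[OF det nz, of "cnj y" y'] knz
    by (simp add: m_def kap)
  have tra: "kernel_exponent (cnj y) (cnj w) y' w' = kernel_exponent (cnj z) (cnj w) z' w'
      + \<alpha> * (cnj z + cnj y) / 2 + cnj \<alpha> * (z' + y') / 2"
    using kernel_exponent_translate[OF nz, of "cnj z" "cnj \<alpha>" \<alpha> z'] by (simp add: yy gam_def)
  have ln: "Ln (1 - cnj (m w) * m w') = Ln (1 - cnj w * w') - cnj (L g w) - L g w'"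
    using Ln_one_minus_moebius[OF g assms(2)[OF g] w w'] by (simp add: m_def ab)
  have mm: "m w \<in> unit_disc" "m w' \<in> unit_disc"
    using moebius_in_unit_disc[OF g] w w' by (simp_all add: m_def ab)
  have "jacobi_kernel k (jacobi_act h x) (jacobi_act h x')
      = jacobi_kernel k (y / kappa g w, m w) (y' / kappa g w', m w')"
    by (simp add: eqs jacobi_act_def m_def ab yy)
  \<comment> \<open>The three summands are exponents of the conjugated multiplier at
    \<open>x\<close>, of the kernel, and of the multiplier at \<open>x'\<close>.\<close>
  also have "\<dots> = exp ((2 * k * cnj (L g w) + 1 / 2 * (b / cnj (kappa g w) * (cnj y)\<^sup>2 + \<alpha> * (cnj z + cnj y)))
      + (- 2 * k * Ln (1 - cnj w * w') + kernel_exponent (cnj z) (cnj w) z' w')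
      + (2 * k * L g w' + 1 / 2 * (cnj b / kappa g w' * y'\<^sup>2 + cnj \<alpha> * (z' + y'))))"
    unfolding kernel[OF mm] mob tra ln by (intro arg_cong[of _ _ exp]) (simp add: field_simps)
  also have "\<dots> = cnj (jacobi_J k L h x) * jacobi_kernel k x x' * jacobi_J k L h x'"
    unfolding eqs kernel[OF w w'] jacobi_J_def
    by (simp add: exp_add exp_cnj yy ab)
  finally show "jacobi_kernel k (jacobi_act h x) (jacobi_act h x')
      = cnj (jacobi_J k L h x) * jacobi_kernel k x x' * jacobi_J k L h x'" .
qed

end
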